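(* For every connected graph $G$, $\mathrm{load}(G) = \mathrm{td}(G)$.
   Context: A cut decomposition of a graph $G$ is a pair $(X,\mathcal{C})$ where $X$ is a rooted tree and $\mathcal{C}=\{C_x\subseteq V(G): x\in V(X)\}$ such that: every $v\in V(G)$ lies in $C_x$ for a unique $x$; for every edge $uv$ there are $x,y$ with $u\in C_x$, $v\in C_y$ and $x$ an ancestor of $y$ (a node is its own ancestor); for every non-leaf $y$, $C_y$ is a cut set of $G[\bigcup_{x\in\Lambda_X(y)}C_x]$, where $\Lambda_X(y)$ is the subtree of $X$ rooted at $y$. $\mathrm{load}(x)=|C_x|$ for a leaf $x$, and $\mathrm{load}(x)=|C_x|+\max_y\mathrm{load}(y)$ over children $y$ otherwise; $\mathrm{load}(G)$ is the minimum, over all cut decompositions of $G$, of the load of the root. For a rooted tree $T$, its closure $\mathrm{clos}(T)$ is $T$ together with all edges $uv$ with $u$ an ancestor of $v$; the height of $T$ is the maximum number of edges on a path from the root to a vertex. The treedepth $\mathrm{td}(G)$ of a connected graph $G$ is $1$ plus the minimum height of a rooted tree $T$ with $V(T)=V(G)$ and $G\subseteq \mathrm{clos}(T)$. *)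

theory Defs
  imports "Graph_Theory.Graph_Theory"
begin

text \<open>
  A finite simple graph is a \<^const>\<open>pair_graph\<close>: an edge \<open>uv\<close> is represented by the two
  arcs \<open>(u, v)\<close> and \<open>(v, u)\<close>.

  A rooted tree is represented by its orientation away from the root, i.e. the arcs are the
  pairs (parent, child).  So ``\<open>x\<close> is an ancestor of \<open>y\<close>'' (with every node an ancestor of
  itself) is reachability of \<open>y\<close> from \<open>x\<close>.  The library's \<^const>\<open>tree\<close> only excludes directed
  cycles, hence it describes neither undirected trees (as symmetric digraphs) nor
  arborescences and is not used.
\<close>

definition rooted_tree :: "'x pair_pre_digraph \<Rightarrow> 'x \<Rightarrow> bool" where
  "rooted_tree T r \<longleftrightarrow> pair_fin_digraph T \<and> r \<in> pverts T \<and>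
     (\<forall>v \<in> pverts T. \<exists>!p. pre_digraph.awalk T r p v)"

abbreviation ancestor :: "'x pair_pre_digraph \<Rightarrow> 'x \<Rightarrow> 'x \<Rightarrow> bool" where
  "ancestor T x y \<equiv> x \<rightarrow>\<^sup>*\<^bsub>with_proj T\<^esub> y"

definition children :: "'x pair_pre_digraph \<Rightarrow> 'x \<Rightarrow> 'x set" where
  "children T x = {y. (x, y) \<in> parcs T}"

definition is_leaf :: "'x pair_pre_digraph \<Rightarrow> 'x \<Rightarrow> bool" where
  "is_leaf T x \<longleftrightarrow> x \<in> pverts T \<and> children T x = {}"

definition subtree_nodes :: "'x pair_pre_digraph \<Rightarrow> 'x \<Rightarrow> 'x set" where
  "subtree_nodes T y = {x \<in> pverts T. ancestor T y x}"

definition height :: "'x pair_pre_digraph \<Rightarrow> 'x \<Rightarrow> nat" where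
  "height T r = Max {length p | p v. pre_digraph.apath T r p v}"

definition clos :: "'x pair_pre_digraph \<Rightarrow> 'x pair_pre_digraph" where
  "clos T = \<lparr> pverts = pverts T,
     parcs = {(u, v). u \<noteq> v \<and> (ancestor T u v \<or> ancestor T v u)} \<rparr>"

definition treedepth :: "'a pair_pre_digraph \<Rightarrow> nat" where
  "treedepth G = 1 + (LEAST h. \<exists>T r. rooted_tree T r \<and> pverts T = pverts G \<and>
     subgraph G (clos T) \<and> h = height T r)"

text \<open>
  The graph without vertices is not \<^const>\<open>connected\<close> in the library; it must not count as
  disconnected either, so deleting all vertices is excluded explicitly.
\<close>

definition cut_set :: "('a, 'b) pre_digraph \<Rightarrow> 'a set \<Rightarrow> bool" where
  "cut_set H S \<longleftrightarrow> S \<subseteq> verts H \<and> verts H - S \<noteq> {} \<and> \<not> connected (H \<restriction> (verts H - S))"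

text \<open>
  Edges of \<open>G\<close> are unordered, so either end of an arc may be the one in the upper bag.
\<close>

definition cut_decomposition ::
  "'a pair_pre_digraph \<Rightarrow> 'x pair_pre_digraph \<Rightarrow> 'x \<Rightarrow> ('x \<Rightarrow> 'a set) \<Rightarrow> bool" where
  "cut_decomposition G X r C \<longleftrightarrow>
     rooted_tree X r \<and>
     (\<forall>x \<in> pverts X. C x \<subseteq> pverts G) \<and>
     (\<forall>v \<in> pverts G. \<exists>!x. x \<in> pverts X \<and> v \<in> C x) \<and>
     (\<forall>(u, v) \<in> parcs G. \<exists>x \<in> pverts X. \<exists>y \<in> pverts X.
        u \<in> C x \<and> v \<in> C y \<and> (ancestor X x y \<or> ancestor X y x)) \<and>
     (\<forall>y \<in> pverts X. \<not> is_leaf X y \<longrightarrow>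
        cut_set (G \<restriction> (\<Union>x \<in> subtree_nodes X y. C x)) (C y))"

definition child_rel :: "(('x pair_pre_digraph \<times> ('x \<Rightarrow> 'a set) \<times> 'x) \<times> ('x pair_pre_digraph \<times> ('x \<Rightarrow> 'a set) \<times> 'x)) set" where
  "child_rel = {((X, C, y), (X', C', x)). X' = X \<and> C' = C \<and>
     finite (parcs X) \<and> acyclic (parcs X) \<and> (x, y) \<in> parcs X}"

lemma wf_child_rel: "wf (child_rel :: (('x pair_pre_digraph \<times> ('x \<Rightarrow> 'a set) \<times> 'x) \<times> _) set)"
proof (rule wfUNIVI)
  fix P :: "'x pair_pre_digraph \<times> ('x \<Rightarrow> 'a set) \<times> 'x \<Rightarrow> bool" and z :: "'x pair_pre_digraph \<times> ('x \<Rightarrow> 'a set) \<times> 'x"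
  assume step: "\<forall>z. (\<forall>w. (w, z) \<in> child_rel \<longrightarrow> P w) \<longrightarrow> P z"
  obtain X C x where z: "z = (X, C, x)" by (cases z)
  show "P z"
  proof (cases "finite (parcs X) \<and> acyclic (parcs X)")
    case True
    then have "wf ((parcs X)\<inverse>)" by (simp add: finite_acyclic_wf_converse)
    then have "P (X, C, x)"
    proof (induction x rule: wf_induct_rule)
      case (less x)
      show ?case by (rule step[rule_format]) (auto simp: child_rel_def intro: less)
    qed
    then show ?thesis using z by simp
  next
    case False
    show ?thesis unfolding z
      by (rule step[rule_format]) (use False in \<open>auto simp: child_rel_def\<close>)
  qed
qed

text \<open>
  The guard only serves termination: it holds in every rooted tree, see
  \<open>rooted_tree_acyclic\<close> and the equations \<open>node_load_leaf\<close> and \<open>node_load_nonleaf\<close>.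
\<close>

function node_load :: "'x pair_pre_digraph \<Rightarrow> ('x \<Rightarrow> 'a set) \<Rightarrow> 'x \<Rightarrow> nat" where
  "node_load X C x =
     (if finite (parcs X) \<and> acyclic (parcs X) \<and> children X x \<noteq> {}
      then card (C x) + Max (node_load X C ` children X x)
      else card (C x))"
  by pat_completeness auto
termination
  by (relation child_rel, rule wf_child_rel) (simp add: child_rel_def children_def)

declare node_load.simps [simp del]

lemma rooted_tree_acyclic:
  assumes "rooted_tree T r"
  shows "finite (parcs T)" and "acyclic (parcs T)"
proof -
  interpret pair_fin_digraph T using assms by (simp add: rooted_tree_def)
  show "finite (parcs T)" by simp
  show "acyclic (parcs T)"
  proof (rule acyclicI, intro allI notI)
    fix x assume cyc: "(x, x) \<in> (parcs T)\<^sup>+"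
    then have x: "x \<in> pverts T" using reachable1_in_verts(1) by simp
    obtain y where xy: "(x, y) \<in> parcs T" and "(y, x) \<in> (parcs T)\<^sup>*"
      using cyc by (meson tranclD)
    moreover have "y \<in> pverts T" using xy in_arcsD2 by blast
    ultimately have "y \<rightarrow>\<^sup>*\<^bsub>with_proj T\<^esub> x" by (simp add: reachable_conv')
    then obtain q where q: "awalk y q x" using reachable_awalk by blast
    have c: "awalk x ((x, y) # q) x" using q xy x by (auto simp: awalk_def)
    obtain p where p: "awalk r p x" using assms x unfolding rooted_tree_def by blast
    have "awalk r (p @ (x, y) # q) x" using p c by (rule awalk_appendI)
    then show False using p assms x unfolding rooted_tree_def by blast
  qed
qed

lemma node_load_leaf:
  assumes "is_leaf X x"
  shows "node_load X C x = card (C x)"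
  using assms by (simp add: is_leaf_def node_load.simps)

lemma node_load_nonleaf:
  assumes "rooted_tree X r" and "x \<in> pverts X" and "\<not> is_leaf X x"
  shows "node_load X C x = card (C x) + Max (node_load X C ` children X x)"
  using assms rooted_tree_acyclic[OF assms(1)]
  by (subst node_load.simps) (simp add: is_leaf_def)

text \<open>
  Rooted trees are finite, so natural numbers as tree nodes cover all cut decompositions up to
  renaming of nodes.
\<close>

definition load :: "'a pair_pre_digraph \<Rightarrow> nat" where
  "load G = (LEAST k. \<exists>(X :: nat pair_pre_digraph) r C.
     cut_decomposition G X r C \<and> k = node_load X C r)"

end

theory Submission
  imports Defs
begin

text \<open>
  Both parameters are compared with a recursive notion of vertex elimination: remove a vertex from a
  connected graph, pass to the components, and count the depth. Given any tree whose bags partition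
  the vertices so that every edge joins ancestor-related bags, eliminating the bags from the root
  downwards takes as many steps as the load of the root; singleton bags give the height plus one.
  Conversely, an elimination yields an elimination tree directly. It yields a cut decomposition if
  the removed vertices are gathered in one bag for as long as the rest stays connected: a new node is
  opened only when the rest falls apart, so every bag of a non-leaf is a cut set.
\<close>

section \<open>Rooted trees\<close>

text \<open>Gathering loses nothing because a bag of size \<open>c\<close> pays for exactly the
  \<open>c\<close> eliminations it absorbs, and its cost is shared by all branches below it.
  Conversely, a bag may be eliminated vertex by vertex in any order, so the cut condition is needed
  only for producing decompositions, not for the bound by elimination depth. Passing to components
  is the awkward step: a node then has a whole family of subtrees. The elimination predicate
  therefore splits off one separated part at a time, and trees are assembled by attaching one
  subtree to the root at a time. While this goes on, the cut condition at the root speaks about a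
  vertex set that is still growing, so it is kept apart from the conditions at the other nodes and
  established only when all components are attached.\<close>

lemma rooted_tree_arcs_in_verts:
  assumes "rooted_tree T r" and "(x, y) \<in> parcs T"
  shows "x \<in> pverts T" and "y \<in> pverts T"
proof -
  interpret pair_fin_digraph T using assms by (simp add: rooted_tree_def)
  show "x \<in> pverts T" "y \<in> pverts T" using assms(2) in_arcsD1 in_arcsD2 by blast+
qed

lemma rooted_tree_rtrancl_in_verts:
  assumes "rooted_tree T r" and "(x, y) \<in> (parcs T)\<^sup>*" and "x \<in> pverts T"
  shows "y \<in> pverts T"
  using assms(2,3) by induction (auto dest: rooted_tree_arcs_in_verts[OF assms(1)])

text \<open>Library reachability is reflexive on vertices only, hence the membership condition.
  Later arguments use closures of \<open>parcs T\<close> instead of walks.\<close>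

lemma ancestor_iff:
  assumes "rooted_tree T r"
  shows "ancestor T x y \<longleftrightarrow> x \<in> pverts T \<and> (x, y) \<in> (parcs T)\<^sup>*"
proof -
  interpret pair_fin_digraph T using assms by (simp add: rooted_tree_def)
  show ?thesis
    using reachable_conv'[of x y] reachable_in_verts(1)[of x y] by auto
qed

lemma subtree_nodes_eq:
  assumes "rooted_tree T r" and "y \<in> pverts T"
  shows "subtree_nodes T y = {x. (y, x) \<in> (parcs T)\<^sup>*}"
  using assms rooted_tree_rtrancl_in_verts[OF assms(1)]
  by (auto simp: subtree_nodes_def ancestor_iff)

lemma finite_children:
  assumes "rooted_tree T r"
  shows "finite (children T x)"
  using finite_imageI[OF rooted_tree_acyclic(1)[OF assms], of snd]
  by (rule rev_finite_subset) (force simp: children_def)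

lemma rooted_tree_root_reaches:
  assumes "rooted_tree T r" and "v \<in> pverts T"
  shows "(r, v) \<in> (parcs T)\<^sup>*"
proof -
  interpret pair_fin_digraph T using assms by (simp add: rooted_tree_def)
  obtain p where "awalk r p v" using assms by (auto simp: rooted_tree_def)
  then have "r \<rightarrow>\<^sup>*\<^bsub>with_proj T\<^esub> v" by (rule reachable_awalkI)
  then show ?thesis by (simp add: ancestor_iff[OF assms(1)])
qed

text \<open>Two parents would extend to two walks from the root to \<open>z\<close> that differ in
  their last arc.\<close>

lemma rooted_tree_parent_unique:
  assumes "rooted_tree T r" and "(x, z) \<in> parcs T" and "(y, z) \<in> parcs T"
  shows "x = y"
proof -
  interpret pair_fin_digraph T using assms by (simp add: rooted_tree_def)
  have v: "x \<in> pverts T" "y \<in> pverts T" "z \<in> pverts T"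
    using assms rooted_tree_arcs_in_verts by metis+
  obtain p q where "awalk r p x" "awalk r q y"
    using assms v unfolding rooted_tree_def by meson
  moreover have "awalk x [(x, z)] z" "awalk y [(y, z)] z"
    using assms v by (auto simp: awalk_def)
  ultimately have "awalk r (p @ [(x, z)]) z" "awalk r (q @ [(y, z)]) z"
    by (meson awalk_appendI)+
  then have "p @ [(x, z)] = q @ [(y, z)]"
    using assms v unfolding rooted_tree_def by blast
  then show ?thesis by simp
qed

lemma rooted_tree_no_arc_to_root:
  assumes "rooted_tree T r"
  shows "(x, r) \<notin> parcs T"
proof
  assume *: "(x, r) \<in> parcs T"
  then have "(r, x) \<in> (parcs T)\<^sup>*"
    using assms rooted_tree_root_reaches rooted_tree_arcs_in_verts by metis
  with * show False using rooted_tree_acyclic(2)[OF assms]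
    by (meson acyclic_def rtrancl_into_trancl1)
qed

text \<open>Replaces unique walks by conditions that are easy to check for constructed trees.
  Uniqueness follows by peeling off last arcs: each is determined by its head, and no arc enters the
  root.\<close>

lemma rooted_treeI:
  assumes fin: "finite (pverts T)" and wf: "parcs T \<subseteq> pverts T \<times> pverts T"
    and root: "r \<in> pverts T" "\<And>x. (x, r) \<notin> parcs T"
    and reach: "\<And>v. v \<in> pverts T \<Longrightarrow> (r, v) \<in> (parcs T)\<^sup>*"
    and unique: "\<And>x y z. (x, z) \<in> parcs T \<Longrightarrow> (y, z) \<in> parcs T \<Longrightarrow> x = y"
  shows "rooted_tree T r"
proof -
  interpret pair_fin_digraph T
    using fin wf finite_subset[OF wf] by unfold_locales auto
  have "p = q" if "awalk r p v" "awalk r q v" for p q v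
    using that
  proof (induction p arbitrary: q v rule: rev_induct)
    case Nil
    then have "v = r" by (simp add: awalk_def)
    then show ?case using Nil.prems(2) root(2)
      by (cases q rule: rev_cases) (auto simp: awalk_def)
  next
    case (snoc e p)
    obtain x where e: "e = (x, v)" "(x, v) \<in> parcs T" "awalk r p x"
      using snoc.prems(1) by (cases e) (auto simp: awalk_def)
    have "q \<noteq> []" using snoc.prems(2) e(2) root(2) by (auto simp: awalk_def)
    then obtain q' e' where q: "q = q' @ [e']" by (cases q rule: rev_cases) auto
    obtain y where e': "e' = (y, v)" "(y, v) \<in> parcs T" "awalk r q' y"
      using snoc.prems(2) q by (cases e') (auto simp: awalk_def)
    have "y = x" using unique e(2) e'(2) by blast
    then show ?case using snoc.IH[OF e(3)] e' e(1) q by simp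
  qed
  moreover have "\<exists>p. awalk r p v" if "v \<in> pverts T" for v
    using reach[OF that] root(1) that reachable_conv' reachable_awalk by auto
  ultimately show ?thesis
    unfolding rooted_tree_def using root(1) by blast
qed

text \<open>Reversed arcs are single-valued, so the ancestors of \<open>w\<close> form a chain and
  \<open>y\<close>, \<open>z\<close> are comparable. A sibling strictly below another would have
  \<open>x\<close> between them, which closes a cycle.\<close>

lemma children_subtrees_disjoint:
  assumes T: "rooted_tree T r" and y: "y \<in> children T x" and z: "z \<in> children T x"
    and "(y, w) \<in> (parcs T)\<^sup>*" "(z, w) \<in> (parcs T)\<^sup>*"
  shows "y = z"
proof -
  have sibling: "a = b" if ab: "(a, b) \<in> (parcs T)\<^sup>*" "(x, a) \<in> parcs T" "(x, b) \<in> parcs T" for a b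
  proof (rule ccontr)
    assume "a \<noteq> b"
    then obtain c where c: "(a, c) \<in> (parcs T)\<^sup>*" "(c, b) \<in> parcs T"
      using ab(1) by (metis rtranclE)
    then have "c = x" using rooted_tree_parent_unique[OF T] that(3) by blast
    then have "(x, x) \<in> (parcs T)\<^sup>+" using that(2) c(1) by (meson rtrancl_into_trancl2)
    then show False using rooted_tree_acyclic(2)[OF T] by (simp add: acyclic_def)
  qed
  have "single_valued ((parcs T)\<inverse>)"
    using rooted_tree_parent_unique[OF T] by (auto simp: single_valued_def)
  moreover have "(w, y) \<in> ((parcs T)\<inverse>)\<^sup>*" "(w, z) \<in> ((parcs T)\<inverse>)\<^sup>*"
    using assms by (auto intro: rtrancl_converseI)
  ultimately have "(y, z) \<in> ((parcs T)\<inverse>)\<^sup>* \<or> (z, y) \<in> ((parcs T)\<inverse>)\<^sup>*"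
    by (rule single_valued_confluent)
  then have "(z, y) \<in> (parcs T)\<^sup>* \<or> (y, z) \<in> (parcs T)\<^sup>*"
    by (auto dest: rtrancl_converseD)
  then show ?thesis using sibling y z by (auto simp: children_def)
qed

text \<open>Removes both \<open>Max\<close> and the leaf case distinction; loads are compared
  through their upper bounds from here on. The first conjunct carries the leaf case.\<close>

lemma node_load_le_iff:
  assumes "rooted_tree T r" and "x \<in> pverts T"
  shows "node_load T C x \<le> k \<longleftrightarrow>
    card (C x) \<le> k \<and> (\<forall>y \<in> children T x. card (C x) + node_load T C y \<le> k)"
proof (cases "is_leaf T x")
  case True
  then show ?thesis by (simp add: node_load_leaf) (simp add: is_leaf_def)
next
  case False
  then have ne: "children T x \<noteq> {}" using assms(2) by (simp add: is_leaf_def)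
  let ?L = "node_load T C ` children T x"
  have "node_load T C x \<le> k \<longleftrightarrow> card (C x) \<le> k \<and> Max ?L \<le> k - card (C x)"
    by (auto simp: node_load_nonleaf[OF assms False])
  also have "\<dots> \<longleftrightarrow> card (C x) \<le> k \<and> (\<forall>y \<in> children T x. node_load T C y \<le> k - card (C x))"
    using ne finite_children[OF assms(1)] by (subst Max_le_iff) auto
  finally show ?thesis by (auto simp: le_diff_conv2 add.commute)
qed

text \<open>\<open>W\<close> is closed under children: a load depends only on what lies below the
  node, so it survives changes elsewhere in the tree.\<close>

lemma node_load_cong:
  assumes T: "rooted_tree T r" and T': "rooted_tree T' r'"
    and W: "\<And>z. z \<in> W \<Longrightarrow> z \<in> pverts T \<and> z \<in> pverts T' \<and> children T z = children T' z
      \<and> children T z \<subseteq> W \<and> C z = C' z"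
    and "x \<in> W"
  shows "node_load T C x = node_load T' C' x"
  using \<open>x \<in> W\<close>
proof (induction x rule: wf_induct_rule[OF finite_acyclic_wf_converse[OF rooted_tree_acyclic[OF T]]])
  case (1 x)
  have "node_load T C y = node_load T' C' y" if "y \<in> children T x" for y
    using 1(1)[of y] W[OF 1(2)] that unfolding children_def by blast
  then have "node_load T C x \<le> k \<longleftrightarrow> node_load T' C' x \<le> k" for k
    using W[OF 1(2)] by (simp add: node_load_le_iff[OF T] node_load_le_iff[OF T'])
  then show ?case by (meson order_antisym order_refl)
qed

lemma rtrancl_cong_on_closed:
  assumes W: "\<And>z. z \<in> W \<Longrightarrow> R `` {z} = R' `` {z} \<and> R `` {z} \<subseteq> W" and "x \<in> W"
  shows "(x, y) \<in> R\<^sup>* \<longleftrightarrow> (x, y) \<in> R'\<^sup>*"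
proof -
  have "(x, y) \<in> R'\<^sup>* \<and> y \<in> W" if "(x, y) \<in> R\<^sup>*"
    using that
  proof induction
    case (step y z)
    then show ?case using W[of y] by (auto intro: rtrancl_into_rtrancl)
  qed (use assms in auto)
  moreover have "(x, y) \<in> R\<^sup>* \<and> y \<in> W" if "(x, y) \<in> R'\<^sup>*"
    using that
  proof induction
    case (step y z)
    then show ?case using W[of y] by (auto intro: rtrancl_into_rtrancl)
  qed (use assms in auto)
  ultimately show ?thesis by blast
qed

text \<open>With singleton bags the load counts the vertices of a longest downward walk, whereas the
  height counts its edges; hence \<open>Suc\<close>.\<close>

lemma node_load_singletons:
  assumes T: "rooted_tree T r"
  shows "node_load T (\<lambda>x. {x}) r = Suc (height T r)"
proof -
  interpret pair_fin_digraph T using assms by (simp add: rooted_tree_def)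
  let ?L = "node_load T (\<lambda>x. {x})"
  have upper: "Suc (length p) \<le> ?L x" if "awalk x p v" for x p v
    using that
  proof (induction p arbitrary: x)
    case Nil
    then show ?case using node_load_le_iff[OF T, of x "\<lambda>x. {x}" "?L x"]
      by (auto simp: awalk_def)
  next
    case (Cons e p)
    then obtain y where e: "e = (x, y)" "(x, y) \<in> parcs T" "awalk y p v"
      by (cases e) (auto simp: awalk_Cons_iff)
    then have "Suc (length p) \<le> ?L y" using Cons.IH by blast
    moreover have "1 + ?L y \<le> ?L x"
      using node_load_le_iff[OF T, of x "\<lambda>x. {x}" "?L x"] e(2) rooted_tree_arcs_in_verts[OF T e(2)]
      by (auto simp: children_def)
    ultimately show ?case by simp
  qed
  have attained: "\<exists>p v. awalk x p v \<and> Suc (length p) = ?L x" if "x \<in> pverts T" for x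
    using that
  proof (induction x rule: wf_induct_rule[OF finite_acyclic_wf_converse[OF rooted_tree_acyclic[OF T]]])
    case (1 x)
    show ?case
    proof (cases "is_leaf T x")
      case True
      then have "awalk x [] x \<and> Suc (length []) = ?L x"
        using 1 by (simp add: awalk_Nil_iff node_load_leaf)
      then show ?thesis by blast
    next
      case False
      then have "children T x \<noteq> {}" using 1 by (simp add: is_leaf_def)
      then have "Max (?L ` children T x) \<in> ?L ` children T x"
        using finite_children[OF T] by (intro Max_in) auto
      then obtain y where y: "y \<in> children T x" "?L x = Suc (?L y)"
        using node_load_nonleaf[OF T 1(2) False, of "\<lambda>x. {x}"] by auto
      then have arc: "(x, y) \<in> parcs T" by (simp add: children_def)
      then obtain p v where "awalk y p v" "Suc (length p) = ?L y"
        using 1(1)[of y] rooted_tree_arcs_in_verts[OF T arc] by auto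
      then have "awalk x ((x, y) # p) v \<and> Suc (length ((x, y) # p)) = ?L x"
        using arc y by (auto simp: awalk_Cons_iff)
      then show ?thesis by blast
    qed
  qed
  have r: "r \<in> pverts T" using T by (simp add: rooted_tree_def)
  obtain p v where p: "awalk r p v" "Suc (length p) = ?L r" using attained[OF r] by blast
  \<comment> \<open>Height ranges over paths only. Removing loops from \<open>p\<close> keeps its
    ends, so by uniqueness of walks from the root nothing was removed.\<close>
  have "apath r p v"
  proof -
    have "apath r (awalk_to_apath p) v" using p(1) by (rule apath_awalk_to_apath)
    moreover from this have "awalk r (awalk_to_apath p) v" by (rule awalkI_apath)
    then have "awalk_to_apath p = p"
      using T p(1) awalk_last_in_verts[OF p(1)] unfolding rooted_tree_def by blast
    ultimately show ?thesis by simp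
  qed
  then have "height T r = length p"
    unfolding height_def
  proof (intro Max_eqI)
    show "finite {length p |p v. apath r p v}"
      by (rule finite_subset[of _ "{..?L r}"]) (auto dest!: awalkI_apath upper)
  next
    fix n assume "n \<in> {length p |p v. apath r p v}"
    then obtain q w where "n = length q" "awalk r q w" by (auto dest: awalkI_apath)
    then show "n \<le> length p" using upper[of r q w] p(2) by simp
  qed blast
  then show ?thesis using p(2) by simp
qed

section \<open>Grafting\<close>

text \<open>Attaches \<open>T'\<close> as one more child subtree of the root. Both elimination trees
  and cut decompositions are built by iterating this.\<close>

definition graft :: "'x pair_pre_digraph \<Rightarrow> 'x \<Rightarrow> 'x pair_pre_digraph \<Rightarrow> 'x \<Rightarrow> 'x pair_pre_digraph" where
  "graft T r T' r' = \<lparr> pverts = pverts T \<union> pverts T', parcs = insert (r, r') (parcs T \<union> parcs T') \<rparr>"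

context
  fixes T T' :: "'x pair_pre_digraph" and r r' :: 'x
  assumes T: "rooted_tree T r" and T': "rooted_tree T' r'"
    and disj: "pverts T \<inter> pverts T' = {}"
begin

lemma graft_root_verts: "r \<in> pverts T" "r' \<in> pverts T'"
  using T T' by (auto simp: rooted_tree_def)

lemma children_graft:
  "children (graft T r T' r') x =
    (if x = r then insert r' (children T r) else if x \<in> pverts T then children T x else children T' x)"
  using disj graft_root_verts
  by (auto simp: children_def graft_def dest: rooted_tree_arcs_in_verts[OF T] rooted_tree_arcs_in_verts[OF T'])

lemma rooted_tree_graft: "rooted_tree (graft T r T' r') r"
proof (rule rooted_treeI)
  have fin: "finite (pverts T)" "finite (pverts T')"
    using T T' by (auto simp: rooted_tree_def pair_fin_digraph_def pair_fin_digraph_axioms_def)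
  then show "finite (pverts (graft T r T' r'))" by (simp add: graft_def)
  show "parcs (graft T r T' r') \<subseteq> pverts (graft T r T' r') \<times> pverts (graft T r T' r')"
    using graft_root_verts
    by (auto simp: graft_def dest: rooted_tree_arcs_in_verts[OF T] rooted_tree_arcs_in_verts[OF T'])
  show "r \<in> pverts (graft T r T' r')" using graft_root_verts by (simp add: graft_def)
  show "(x, r) \<notin> parcs (graft T r T' r')" for x
    using graft_root_verts disj rooted_tree_no_arc_to_root[OF T]
    by (auto simp: graft_def dest: rooted_tree_arcs_in_verts[OF T'])
  show "x = y" if "(x, z) \<in> parcs (graft T r T' r')" "(y, z) \<in> parcs (graft T r T' r')" for x y z
    using that disj graft_root_verts rooted_tree_no_arc_to_root[OF T']
      rooted_tree_parent_unique[OF T] rooted_tree_parent_unique[OF T']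
    by (auto simp: graft_def dest: rooted_tree_arcs_in_verts[OF T] rooted_tree_arcs_in_verts[OF T'])
  fix v assume v: "v \<in> pverts (graft T r T' r')"
  have sub: "(parcs T)\<^sup>* \<subseteq> (parcs (graft T r T' r'))\<^sup>*" "(parcs T')\<^sup>* \<subseteq> (parcs (graft T r T' r'))\<^sup>*"
    by (intro rtrancl_mono; auto simp: graft_def)+
  show "(r, v) \<in> (parcs (graft T r T' r'))\<^sup>*"
  proof (cases "v \<in> pverts T")
    case True
    then show ?thesis using sub rooted_tree_root_reaches[OF T] by blast
  next
    case False
    then have "(r', v) \<in> (parcs T')\<^sup>*"
      using v rooted_tree_root_reaches[OF T'] by (simp add: graft_def)
    moreover have "(r, r') \<in> parcs (graft T r T' r')" by (simp add: graft_def)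
    ultimately show ?thesis using sub by (meson converse_rtrancl_into_rtrancl subsetD)
  qed
qed

lemma ancestor_graft_mono:
  "ancestor T x y \<Longrightarrow> ancestor (graft T r T' r') x y"
  "ancestor T' x y \<Longrightarrow> ancestor (graft T r T' r') x y"
proof -
  have "(parcs T)\<^sup>* \<subseteq> (parcs (graft T r T' r'))\<^sup>*" "(parcs T')\<^sup>* \<subseteq> (parcs (graft T r T' r'))\<^sup>*"
    by (intro rtrancl_mono; auto simp: graft_def)+
  then show "ancestor T x y \<Longrightarrow> ancestor (graft T r T' r') x y"
    "ancestor T' x y \<Longrightarrow> ancestor (graft T r T' r') x y"
    by (auto simp: ancestor_iff[OF T] ancestor_iff[OF T'] ancestor_iff[OF rooted_tree_graft])
       (auto simp: graft_def)
qed

text \<open>Only the subtree at \<open>r\<close> changes, since the new arc leaves \<open>r\<close>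
  and nothing enters \<open>r\<close>.\<close>

lemma subtree_nodes_graft:
  "x \<in> pverts T - {r} \<Longrightarrow> subtree_nodes (graft T r T' r') x = subtree_nodes T x"
  "x \<in> pverts T' \<Longrightarrow> subtree_nodes (graft T r T' r') x = subtree_nodes T' x"
proof -
  have im: "parcs X `` {z} = children X z" for X :: "'x pair_pre_digraph" and z
    by (auto simp: children_def)
  show "subtree_nodes (graft T r T' r') x = subtree_nodes T x" if x: "x \<in> pverts T - {r}"
  proof -
    have "(x, y) \<in> (parcs (graft T r T' r'))\<^sup>* \<longleftrightarrow> (x, y) \<in> (parcs T)\<^sup>*" for y
      by (rule rtrancl_cong_on_closed[OF _ x], unfold im)
         (use rooted_tree_no_arc_to_root[OF T] in
           \<open>auto simp: children_graft, auto simp: children_def dest: rooted_tree_arcs_in_verts[OF T]\<close>)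
    then show ?thesis
      using x subtree_nodes_eq[OF T, of x] subtree_nodes_eq[OF rooted_tree_graft, of x]
      by (auto simp: graft_def)
  qed
  show "subtree_nodes (graft T r T' r') x = subtree_nodes T' x" if x: "x \<in> pverts T'"
  proof -
    have "(x, y) \<in> (parcs (graft T r T' r'))\<^sup>* \<longleftrightarrow> (x, y) \<in> (parcs T')\<^sup>*" for y
      by (rule rtrancl_cong_on_closed[OF _ x], unfold im)
         (use disj graft_root_verts in
           \<open>auto simp: children_graft, auto simp: children_def dest: rooted_tree_arcs_in_verts[OF T']\<close>)
    then show ?thesis
      using x subtree_nodes_eq[OF T', of x] subtree_nodes_eq[OF rooted_tree_graft, of x]
      by (auto simp: graft_def)
  qed
qed

lemma node_load_graft_le_iff:
  assumes C: "\<And>x. x \<in> pverts T \<Longrightarrow> D x = C x" and C': "\<And>x. x \<in> pverts T' \<Longrightarrow> D x = C' x"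
  shows "node_load (graft T r T' r') D r \<le> k \<longleftrightarrow>
    node_load T C r \<le> k \<and> card (C r) + node_load T' C' r' \<le> k"
proof -
  have "node_load (graft T r T' r') D y = node_load T C y" if y: "y \<in> children T r" for y
  proof (rule node_load_cong[OF rooted_tree_graft T])
    show y': "y \<in> pverts T - {r}" using y rooted_tree_no_arc_to_root[OF T]
      by (auto simp: children_def dest: rooted_tree_arcs_in_verts[OF T])
    show "z \<in> pverts (graft T r T' r') \<and> z \<in> pverts T \<and>
         children (graft T r T' r') z = children T z \<and>
         children (graft T r T' r') z \<subseteq> pverts T - {r} \<and> D z = C z" if "z \<in> pverts T - {r}" for z
      using that C rooted_tree_no_arc_to_root[OF T] unfolding children_graft
      by (auto simp: graft_def) (auto simp: children_def dest: rooted_tree_arcs_in_verts[OF T])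
  qed
  moreover have "node_load (graft T r T' r') D r' = node_load T' C' r'"
  proof (rule node_load_cong[OF rooted_tree_graft T'])
    show "r' \<in> pverts T'" by (rule graft_root_verts)
    show "z \<in> pverts (graft T r T' r') \<and> z \<in> pverts T' \<and>
         children (graft T r T' r') z = children T' z \<and>
         children (graft T r T' r') z \<subseteq> pverts T' \<and> D z = C' z" if "z \<in> pverts T'" for z
      using that C' disj graft_root_verts unfolding children_graft
      by (auto simp: graft_def) (auto simp: children_def dest: rooted_tree_arcs_in_verts[OF T'])
  qed
  moreover have "r \<in> pverts (graft T r T' r')" using graft_root_verts by (simp add: graft_def)
  ultimately show ?thesis
    using graft_root_verts C
    by (auto simp: node_load_le_iff[OF rooted_tree_graft] node_load_le_iff[OF T] children_graft)
qed

end

section \<open>Trees carrying bags\<close>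

text \<open>Both orientations are tested, so the notion is symmetric in \<open>A\<close> and
  \<open>B\<close> for every relation \<open>E\<close>.\<close>

definition separated :: "('a \<times> 'a) set \<Rightarrow> 'a set \<Rightarrow> 'a set \<Rightarrow> bool" where
  "separated E A B \<longleftrightarrow> (\<forall>a \<in> A. \<forall>b \<in> B. (a, b) \<notin> E \<and> (b, a) \<notin> E)"

text \<open>A cut decomposition stripped of its cut condition and relativised to a vertex set
  \<open>S\<close>. With the bags \<open>{x}\<close> it is an elimination tree, so both parameters
  can be treated together.\<close>

definition bagged_tree ::
  "('a \<times> 'a) set \<Rightarrow> 'x pair_pre_digraph \<Rightarrow> 'x \<Rightarrow> ('x \<Rightarrow> 'a set) \<Rightarrow> 'a set \<Rightarrow> bool" where
  "bagged_tree E X r C S \<longleftrightarrow>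
     rooted_tree X r \<and>
     (\<forall>x \<in> pverts X. C x \<subseteq> S) \<and>
     (\<forall>v \<in> S. \<exists>!x. x \<in> pverts X \<and> v \<in> C x) \<and>
     (\<forall>(u, v) \<in> E. u \<in> S \<longrightarrow> v \<in> S \<longrightarrow> (\<exists>x \<in> pverts X. \<exists>y \<in> pverts X.
        u \<in> C x \<and> v \<in> C y \<and> (ancestor X x y \<or> ancestor X y x)))"

definition bags :: "'x pair_pre_digraph \<Rightarrow> ('x \<Rightarrow> 'a set) \<Rightarrow> 'x \<Rightarrow> 'a set" where
  "bags X C y = (\<Union>x \<in> subtree_nodes X y. C x)"

lemma bagged_treeD:
  assumes "bagged_tree E X r C S"
  shows "rooted_tree X r"
    and "x \<in> pverts X \<Longrightarrow> C x \<subseteq> S"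
    and "x \<in> pverts X \<Longrightarrow> y \<in> pverts X \<Longrightarrow> v \<in> C x \<Longrightarrow> v \<in> C y \<Longrightarrow> x = y"
    and "v \<in> S \<Longrightarrow> \<exists>x \<in> pverts X. v \<in> C x"
    and "(u, v) \<in> E \<Longrightarrow> u \<in> S \<Longrightarrow> v \<in> S \<Longrightarrow>
      \<exists>x \<in> pverts X. \<exists>y \<in> pverts X. u \<in> C x \<and> v \<in> C y \<and> (ancestor X x y \<or> ancestor X y x)"
  using assms unfolding bagged_tree_def by (simp, simp, blast, blast, blast)

lemma bagged_treeI:
  assumes "rooted_tree X r"
    and "\<And>x. x \<in> pverts X \<Longrightarrow> C x \<subseteq> S"
    and "\<And>x y v. x \<in> pverts X \<Longrightarrow> y \<in> pverts X \<Longrightarrow> v \<in> C x \<Longrightarrow> v \<in> C y \<Longrightarrow> x = y"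
    and "\<And>v. v \<in> S \<Longrightarrow> \<exists>x \<in> pverts X. v \<in> C x"
    and "\<And>u v. (u, v) \<in> E \<Longrightarrow> u \<in> S \<Longrightarrow> v \<in> S \<Longrightarrow>
      \<exists>x \<in> pverts X. \<exists>y \<in> pverts X. u \<in> C x \<and> v \<in> C y \<and> (ancestor X x y \<or> ancestor X y x)"
  shows "bagged_tree E X r C S"
proof -
  have "\<exists>!x. x \<in> pverts X \<and> v \<in> C x" if "v \<in> S" for v
    using assms(3,4) that by meson
  then show ?thesis using assms(1,2,5) unfolding bagged_tree_def by auto
qed

lemma bags_root:
  assumes "bagged_tree E X r C S"
  shows "bags X C r = S"
proof -
  note bt = bagged_treeD[OF assms]
  have r: "r \<in> pverts X" using bt(1) by (simp add: rooted_tree_def)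
  have "subtree_nodes X r = pverts X"
    using rooted_tree_root_reaches[OF bt(1)] r
    by (auto simp: subtree_nodes_def ancestor_iff[OF bt(1)])
  then show ?thesis using bt(2,4) by (auto simp: bags_def)
qed

lemma bagged_tree_singleton_node:
  "bagged_tree E \<lparr>pverts = {r}, parcs = {}\<rparr> r (\<lambda>_. S) S"
proof -
  have rt: "rooted_tree \<lparr>pverts = {r}, parcs = {}\<rparr> r" by (rule rooted_treeI) auto
  show ?thesis by (rule bagged_treeI) (auto simp: rt ancestor_iff[OF rt])
qed

text \<open>By separation, an edge between \<open>S\<close> and \<open>S'\<close> has its end in
  \<open>S\<close> inside \<open>C r\<close>, and \<open>r\<close> is an ancestor of every attached
  node.\<close>

lemma bagged_tree_graft:
  assumes X: "bagged_tree E X r C S" and X': "bagged_tree E X' r' C' S'"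
    and disj: "pverts X \<inter> pverts X' = {}" "S \<inter> S' = {}"
    and sep: "separated E (S - C r) S'"
    and C: "\<And>x. x \<in> pverts X \<Longrightarrow> D x = C x" and C': "\<And>x. x \<in> pverts X' \<Longrightarrow> D x = C' x"
  shows "bagged_tree E (graft X r X' r') r D (S \<union> S')"
proof (rule bagged_treeI)
  note bt = bagged_treeD[OF X] and bt' = bagged_treeD[OF X']
  note rt = rooted_tree_graft[OF bt(1) bt'(1) disj(1)]
  have V: "pverts (graft X r X' r') = pverts X \<union> pverts X'" by (simp add: graft_def)
  show "rooted_tree (graft X r X' r') r" by (rule rt)
  show "D x \<subseteq> S \<union> S'" if "x \<in> pverts (graft X r X' r')" for x
    using that bt(2)[of x] bt'(2)[of x] C C' V by auto
  show "x = y" if "x \<in> pverts (graft X r X' r')" "y \<in> pverts (graft X r X' r')" "v \<in> D x" "v \<in> D y"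
    for x y v
  proof -
    have "z \<in> pverts X \<and> v \<in> C z \<and> v \<in> S \<or> z \<in> pverts X' \<and> v \<in> C' z \<and> v \<in> S'"
      if "z \<in> pverts X \<union> pverts X'" "v \<in> D z" for z
      using that bt(2)[of z] bt'(2)[of z] C[of z] C'[of z] by blast
    from this[of x] this[of y] show ?thesis
      using that disj(2) bt(3)[of x y v] bt'(3)[of x y v] unfolding V by blast
  qed
  show "\<exists>x \<in> pverts (graft X r X' r'). v \<in> D x" if "v \<in> S \<union> S'" for v
    using that bt(4)[of v] bt'(4)[of v] C C' unfolding V by blast
  fix u v assume uv: "(u, v) \<in> E" "u \<in> S \<union> S'" "v \<in> S \<union> S'"
  have root: "r \<in> pverts X" using bt(1) by (simp add: rooted_tree_def)
  have above: "ancestor (graft X r X' r') r y" if "y \<in> pverts X'" for y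
    using that root rooted_tree_root_reaches[OF rt] unfolding ancestor_iff[OF rt] V by blast
  note mono = ancestor_graft_mono[OF bt(1) bt'(1) disj(1)]
  consider "u \<in> S" "v \<in> S" | "u \<in> S'" "v \<in> S'" | "u \<in> C r" "v \<in> S'" | "v \<in> C r" "u \<in> S'"
    using uv sep unfolding separated_def by blast
  then show "\<exists>x \<in> pverts (graft X r X' r'). \<exists>y \<in> pverts (graft X r X' r').
      u \<in> D x \<and> v \<in> D y \<and> (ancestor (graft X r X' r') x y \<or> ancestor (graft X r X' r') y x)"
  proof cases
    case 1
    then show ?thesis using bt(5)[OF uv(1)] C mono(1) unfolding V by blast
  next
    case 2
    then show ?thesis using bt'(5)[OF uv(1)] C' mono(2) unfolding V by blast
  next
    case 3
    then show ?thesis using bt'(4)[of v] root above C C' unfolding V by blast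
  next
    case 4
    then show ?thesis using bt'(4)[of u] root above C C' unfolding V by blast
  qed
qed

section \<open>Treedepth by recursive vertex elimination\<close>

text \<open>
  \<open>td_le E S k\<close> says that the graph induced on \<open>S\<close> has treedepth at most \<open>k\<close>. The vertex \<open>v\<close> is
  the root of one tree of an elimination forest, and \<open>B\<close> carries the remaining trees.
\<close>

inductive td_le :: "('a \<times> 'a) set \<Rightarrow> 'a set \<Rightarrow> nat \<Rightarrow> bool" for E where
  td_le_empty: "td_le E {} k"
| td_le_step: "td_le E A k \<Longrightarrow> td_le E B (Suc k) \<Longrightarrow> v \<notin> A \<Longrightarrow> insert v A \<inter> B = {} \<Longrightarrow>
    separated E (insert v A) B \<Longrightarrow> td_le E (insert v A \<union> B) (Suc k)"

lemma td_le_insert: "td_le E A k \<Longrightarrow> v \<notin> A \<Longrightarrow> td_le E (insert v A) (Suc k)"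
  using td_le_step[OF _ td_le_empty] by (fastforce simp: separated_def)

lemma td_le_mono: "td_le E S k \<Longrightarrow> k \<le> l \<Longrightarrow> td_le E S l"
proof (induction arbitrary: l rule: td_le.induct)
  case (td_le_step A k B v)
  then obtain l' where "l = Suc l'" "k \<le> l'" by (cases l) auto
  then show ?case using td_le_step td_le.td_le_step by metis
qed (rule td_le_empty)

text \<open>Elimination forests are placed side by side: induction on the first one, with the second
  appended after its last tree.\<close>

lemma td_le_Un_separated:
  assumes "td_le E A k" and "td_le E B k" and "A \<inter> B = {}" and "separated E A B"
  shows "td_le E (A \<union> B) k"
  using assms
proof (induction rule: td_le.induct)
  case (td_le_step A k A' v)
  have "A' \<inter> B = {}" "separated E A' B" using td_le_step.prems by (auto simp: separated_def)
  then have "td_le E (A' \<union> B) (Suc k)" using td_le_step by blast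
  then have "td_le E (insert v A \<union> (A' \<union> B)) (Suc k)"
    using td_le_step by (intro td_le.td_le_step) (auto simp: separated_def)
  then show ?case by (simp add: Un_assoc)
qed simp

text \<open>If the root \<open>v\<close> of a tree is dropped, what is left of \<open>A\<close> has
  depth \<open>k\<close>, and monotonicity lifts this to \<open>Suc k\<close>.\<close>

lemma td_le_subset:
  assumes "td_le E S k" and "S' \<subseteq> S"
  shows "td_le E S' k"
  using assms
proof (induction arbitrary: S' rule: td_le.induct)
  case (td_le_empty k)
  then show ?case by (simp add: td_le.td_le_empty)
next
  case (td_le_step A k B v)
  have S': "S' = S' \<inter> insert v A \<union> S' \<inter> B" using td_le_step.prems by blast
  have A: "td_le E (S' \<inter> A) k" and B: "td_le E (S' \<inter> B) (Suc k)"
    using td_le_step.IH by auto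
  have "td_le E (S' \<inter> insert v A) (Suc k)"
  proof (cases "v \<in> S'")
    case True
    then show ?thesis using td_le_insert[OF A, of v] td_le_step.hyps by simp
  next
    case False
    then show ?thesis using td_le_mono[OF A, of "Suc k"] by simp
  qed
  then have "td_le E (S' \<inter> insert v A \<union> S' \<inter> B) (Suc k)"
    using B td_le_step.hyps by (intro td_le_Un_separated) (auto simp: separated_def)
  then show ?case using S' by simp
qed

lemma td_le_Un_card:
  assumes "finite U" and "td_le E S k" and "U \<inter> S = {}"
  shows "td_le E (U \<union> S) (card U + k)"
  using assms(1,3)
proof induction
  case (insert u U)
  then show ?case using td_le_insert[of E "U \<union> S" "card U + k" u] by auto
qed (use assms(2) in simp)

lemma td_le_UN_separated:
  assumes "finite I" and "\<And>i. i \<in> I \<Longrightarrow> td_le E (B i) k"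
    and "\<And>i j. i \<in> I \<Longrightarrow> j \<in> I \<Longrightarrow> i \<noteq> j \<Longrightarrow> B i \<inter> B j = {} \<and> separated E (B i) (B j)"
  shows "td_le E (\<Union>i \<in> I. B i) k"
  using assms
proof (induction I)
  case (insert i I)
  have "B i \<inter> B j = {} \<and> separated E (B i) (B j)" if "j \<in> I" for j
    using insert.prems(2)[of i j] insert.hyps(2) that by auto
  moreover have "td_le E (\<Union>i \<in> I. B i) k" using insert.IH insert.prems by blast
  ultimately have "td_le E (B i \<union> (\<Union>i \<in> I. B i)) k"
    using insert.prems(1)[of i] by (intro td_le_Un_separated) (auto simp: separated_def)
  then show ?case by simp
qed (simp add: td_le_empty)

text \<open>Edges join only comparable nodes, so the subtrees of distinct children are separated and
  together cost no more than the heaviest child. Eliminating the bag of \<open>y\<close> beforehand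
  adds its size.\<close>

lemma td_le_bags:
  assumes X: "bagged_tree E X r C S" and S: "finite S" and "y \<in> pverts X"
  shows "td_le E (bags X C y) (node_load X C y)"
  using \<open>y \<in> pverts X\<close>
proof (induction y rule: wf_induct_rule[OF finite_acyclic_wf_converse[OF rooted_tree_acyclic[OF bagged_treeD(1)[OF X]]]])
  case (1 y)
  note bt = bagged_treeD[OF X]
  \<comment> \<open>This is the largest load of a child, or 0 at a leaf; the subtraction is exact
    since the load is at least the size of the bag.\<close>
  define k where "k = node_load X C y - card (C y)"
  have child: "c \<in> pverts X" "(y, c) \<in> parcs X" if "c \<in> children X y" for c
    using that by (auto simp: children_def dest: rooted_tree_arcs_in_verts[OF bt(1)])
  have le: "card (C y) \<le> node_load X C y" "\<And>c. c \<in> children X y \<Longrightarrow> node_load X C c \<le> k"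
    using node_load_le_iff[OF bt(1) 1(2), of C "node_load X C y"] by (auto simp: k_def)
  have in_bags: "v \<in> bags X C x \<longleftrightarrow> (\<exists>z. (x, z) \<in> (parcs X)\<^sup>* \<and> v \<in> C z)" if "x \<in> pverts X" for x v
    using subtree_nodes_eq[OF bt(1) that] by (auto simp: bags_def)
  note closed = rooted_tree_rtrancl_in_verts[OF bt(1)]
  have "td_le E (\<Union>c \<in> children X y. bags X C c) k"
  proof (rule td_le_UN_separated)
    show "td_le E (bags X C c) k" if "c \<in> children X y" for c
      using 1(1)[of c] child[OF that] le(2)[OF that] td_le_mono by blast
    fix c d assume cd: "c \<in> children X y" "d \<in> children X y" "c \<noteq> d"
    note apart = children_subtrees_disjoint[OF bt(1) cd(1,2)]
    have "False" if edge: "(a, b) \<in> E \<or> (b, a) \<in> E" and ab: "a \<in> bags X C c" "b \<in> bags X C d" for a b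
    proof -
      obtain x z where x: "(c, x) \<in> (parcs X)\<^sup>*" "a \<in> C x" and z: "(d, z) \<in> (parcs X)\<^sup>*" "b \<in> C z"
        using ab in_bags[OF child(1)[OF cd(1)]] in_bags[OF child(1)[OF cd(2)]] by blast
      have xz: "x \<in> pverts X" "z \<in> pverts X" using closed x z child cd by metis+
      then have ab: "a \<in> S" "b \<in> S" using bt(2) x z by auto
      have "ancestor X x z \<or> ancestor X z x"
      proof -
        obtain x' z' where "x' \<in> pverts X" "z' \<in> pverts X" "a \<in> C x'" "b \<in> C z'"
          and anc: "ancestor X x' z' \<or> ancestor X z' x'"
          using edge bt(5)[of a b] bt(5)[of b a] ab by blast
        then have "x' = x" "z' = z" using bt(3) xz x(2) z(2) by blast+
        with anc show ?thesis by simp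
      qed
      then have "(x, z) \<in> (parcs X)\<^sup>* \<or> (z, x) \<in> (parcs X)\<^sup>*"
        by (auto simp: ancestor_iff[OF bt(1)])
      then show False using apart cd(3) x(1) z(1) by (meson rtrancl_trans)
    qed
    moreover have False if a: "a \<in> bags X C c" "a \<in> bags X C d" for a
    proof -
      obtain x z where x: "(c, x) \<in> (parcs X)\<^sup>*" "a \<in> C x" and z: "(d, z) \<in> (parcs X)\<^sup>*" "a \<in> C z"
        using a in_bags[OF child(1)[OF cd(1)]] in_bags[OF child(1)[OF cd(2)]] by blast
      then have "x = z" using closed child cd bt(3) by metis
      then show False using apart cd(3) x z by blast
    qed
    ultimately show "bags X C c \<inter> bags X C d = {} \<and> separated E (bags X C c) (bags X C d)"
      unfolding separated_def by blast
  qed (rule finite_children[OF bt(1)])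
  moreover have "finite (C y)" using S bt(2) 1(2) finite_subset by blast
  moreover have "C y \<inter> (\<Union>c \<in> children X y. bags X C c) = {}"
  proof -
    have False if a: "a \<in> C y" "c \<in> children X y" "a \<in> bags X C c" for a c
    proof -
      obtain x where x: "(c, x) \<in> (parcs X)\<^sup>*" "a \<in> C x" using in_bags child a by metis
      then have "x = y" using bt(3) closed child 1(2) a by metis
      then have "(y, y) \<in> (parcs X)\<^sup>+" using x(1) child(2)[OF a(2)] by (meson rtrancl_into_trancl2)
      then show False using rooted_tree_acyclic(2)[OF bt(1)] by (simp add: acyclic_def)
    qed
    then show ?thesis by blast
  qed
  ultimately have "td_le E (C y \<union> (\<Union>c \<in> children X y. bags X C c)) (card (C y) + k)"
    by (intro td_le_Un_card)
  moreover have "bags X C y = C y \<union> (\<Union>c \<in> children X y. bags X C c)"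
  proof -
    have "(y, z) \<in> (parcs X)\<^sup>* \<longleftrightarrow> z = y \<or> (\<exists>c \<in> children X y. (c, z) \<in> (parcs X)\<^sup>*)" for z
      by (auto simp: children_def elim: converse_rtranclE intro: converse_rtrancl_into_rtrancl)
    then have "v \<in> bags X C y \<longleftrightarrow> v \<in> C y \<or> (\<exists>c \<in> children X y. v \<in> bags X C c)" for v
      unfolding in_bags[OF 1(2)] using in_bags[OF child(1), of _ v] by (metis (no_types, lifting))
    then show ?thesis by blast
  qed
  ultimately show ?case using le(1) by (simp add: k_def)
qed

text \<open>An elimination forest is not a tree, so a fresh vertex \<open>v\<close> serves as common
  root at the price of one level. In the inductive step the tree for \<open>insert u A\<close>,
  rooted at \<open>u\<close>, is hung below \<open>v\<close> next to the trees of
  \<open>B\<close>.\<close>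

lemma td_le_imp_bagged_tree_singletons:
  assumes "td_le E S k" and "v \<notin> S"
  shows "\<exists>T. bagged_tree E T v (\<lambda>x. {x}) (insert v S) \<and> pverts T = insert v S \<and>
    node_load T (\<lambda>x. {x}) v \<le> Suc k"
  using assms
proof (induction arbitrary: v rule: td_le.induct)
  case (td_le_empty k)
  let ?T = "\<lparr>pverts = {v}, parcs = {}\<rparr>"
  have "bagged_tree E ?T v (\<lambda>x. {x}) {v}"
    using bagged_tree_singleton_node[of E v "{v}"] by (auto simp: bagged_tree_def)
  moreover have "is_leaf ?T v" by (simp add: is_leaf_def children_def)
  ultimately show ?case by (intro exI[of _ ?T]) (simp add: node_load_leaf)
next
  case (td_le_step A k B u)
  obtain T where T: "bagged_tree E T v (\<lambda>x. {x}) (insert v B)" "pverts T = insert v B"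
    "node_load T (\<lambda>x. {x}) v \<le> Suc (Suc k)"
    using td_le_step.IH(2)[of v] td_le_step.prems by auto
  obtain T' where T': "bagged_tree E T' u (\<lambda>x. {x}) (insert u A)" "pverts T' = insert u A"
    "node_load T' (\<lambda>x. {x}) u \<le> Suc k"
    using td_le_step.IH(1)[of u] td_le_step.hyps by auto
  have disj: "insert v B \<inter> insert u A = {}" using td_le_step by auto
  have "bagged_tree E (graft T v T' u) v (\<lambda>x. {x}) (insert v B \<union> insert u A)"
    using disj td_le_step.hyps td_le_step.prems T(2) T'(2)
    by (intro bagged_tree_graft[OF T(1) T'(1)]) (auto simp: separated_def)
  moreover have "pverts (graft T v T' u) = insert v B \<union> insert u A"
    using T(2) T'(2) by (simp add: graft_def)
  moreover have "node_load (graft T v T' u) (\<lambda>x. {x}) v \<le> Suc (Suc k)"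
    using node_load_graft_le_iff[OF bagged_treeD(1)[OF T(1)] bagged_treeD(1)[OF T'(1)], of "\<lambda>x. {x}" "\<lambda>x. {x}" "\<lambda>x. {x}"]
      T T' disj by auto
  moreover have "insert v (insert u A \<union> B) = insert v B \<union> insert u A" by auto
  ultimately show ?case by metis
qed

section \<open>Connected vertex sets\<close>

text \<open>Turns connectedness into a condition on \<open>separated\<close>, the notion used by
  \<open>td_le\<close>. One direction propagates membership in \<open>A\<close> along paths; the
  other takes for \<open>A\<close> the set reachable from a vertex.\<close>

lemma connected_induce_iff:
  "connected (with_proj G \<restriction> S) \<longleftrightarrow>
    S \<noteq> {} \<and> (\<forall>A \<subseteq> S. A \<noteq> {} \<longrightarrow> separated (parcs G) A (S - A) \<longrightarrow> A = S)"
proof -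
  define H where "H = mk_symmetric (with_proj G \<restriction> S)"
  have V: "pverts H = S" by (simp add: H_def)
  have E: "parcs H = {(u, v). u \<in> S \<and> v \<in> S \<and> ((u, v) \<in> parcs G \<or> (v, u) \<in> parcs G)}"
    by (auto simp: H_def parcs_mk_symmetric)
  interpret H: pair_wf_digraph H by unfold_locales (auto simp: V E)
  have conn: "connected (with_proj G \<restriction> S) \<longleftrightarrow> S \<noteq> {} \<and> (\<forall>u \<in> S. \<forall>v \<in> S. (u, v) \<in> (parcs H)\<^sup>*)"
    using H.reachable_conv' unfolding connected_def H_def[symmetric] strongly_connected_def
    by (simp add: V)
  have "A = S" if c: "\<forall>u \<in> S. \<forall>v \<in> S. (u, v) \<in> (parcs H)\<^sup>*" and A: "A \<subseteq> S" "A \<noteq> {}"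
    "separated (parcs G) A (S - A)" for A
  proof -
    have "v \<in> A" if "(u, v) \<in> (parcs H)\<^sup>*" "u \<in> A" for u v
      using that by induction (use A in \<open>auto simp: E separated_def\<close>)
    then show ?thesis using A c by blast
  qed
  moreover have "(u, v) \<in> (parcs H)\<^sup>*" if uv: "u \<in> S" "v \<in> S"
    and c: "\<forall>A \<subseteq> S. A \<noteq> {} \<longrightarrow> separated (parcs G) A (S - A) \<longrightarrow> A = S" for u v
  proof -
    define A where "A = {w \<in> S. (u, w) \<in> (parcs H)\<^sup>*}"
    have "separated (parcs G) A (S - A)"
      unfolding separated_def A_def
      by (auto simp: E intro: rtrancl_into_rtrancl)
    moreover have "A \<subseteq> S" "u \<in> A" using uv by (auto simp: A_def)
    ultimately have "A = S" using c by blast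
    then show ?thesis using uv by (auto simp: A_def)
  qed
  ultimately show ?thesis unfolding conn by blast
qed

text \<open>A disconnected set has a proper nonempty part separated from the rest. Recursion into it
  keeps separation from all of \<open>S\<close>.\<close>

lemma connected_component_exists:
  assumes "finite S" and "S \<noteq> {}"
  shows "\<exists>Q \<subseteq> S. connected (with_proj G \<restriction> Q) \<and> separated (parcs G) Q (S - Q)"
  using assms
proof (induction S rule: finite_psubset_induct)
  case (psubset S)
  show ?case
  proof (cases "connected (with_proj G \<restriction> S)")
    case True
    then show ?thesis by (auto simp: separated_def)
  next
    case False
    then obtain A where A: "A \<subset> S" "A \<noteq> {}" "separated (parcs G) A (S - A)"
      using psubset.prems by (auto simp: connected_induce_iff)
    then obtain Q where "Q \<subseteq> A" "connected (with_proj G \<restriction> Q)" "separated (parcs G) Q (A - Q)"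
      using psubset.IH[of A] by blast
    then have "Q \<subseteq> S \<and> connected (with_proj G \<restriction> Q) \<and> separated (parcs G) Q (S - Q)"
      using A unfolding separated_def by blast
    then show ?thesis by blast
  qed
qed

text \<open>In a connected set the part \<open>B\<close> of an elimination step must be empty, so
  the forest is a single tree with root \<open>v\<close>.\<close>

lemma td_le_connected_cases:
  assumes "td_le (parcs G) S k" and "connected (with_proj G \<restriction> S)"
  obtains v l where "v \<in> S" "k = Suc l" "td_le (parcs G) (S - {v}) l"
  using assms(1)
proof cases
  case td_le_empty
  then show ?thesis using assms(2) by (simp add: connected_induce_iff)
next
  case (td_le_step A l B v)
  then have "S - insert v A = B" by auto
  then have "insert v A = S"
    using assms(2) td_le_step unfolding connected_induce_iff by blast
  then have "S - {v} = A" "v \<in> S" using td_le_step(5) by auto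
  then show ?thesis using that[of v l] td_le_step by simp
qed

section \<open>Cut decompositions from eliminations\<close>

lemma cut_set_induce_iff:
  "cut_set (with_proj G \<restriction> S) U \<longleftrightarrow>
    U \<subseteq> S \<and> S - U \<noteq> {} \<and> \<not> connected (with_proj G \<restriction> (S - U))"
proof -
  have "(with_proj G \<restriction> S) \<restriction> (S - U) = with_proj G \<restriction> (S - U)"
    by (auto simp: induce_subgraph_def)
  then show ?thesis by (simp add: cut_set_def)
qed

text \<open>The root is exempt because each graft enlarges the vertex set below it; the other nodes
  keep theirs.\<close>

definition inner_cuts :: "'a pair_pre_digraph \<Rightarrow> 'x pair_pre_digraph \<Rightarrow> 'x \<Rightarrow> ('x \<Rightarrow> 'a set) \<Rightarrow> bool" where
  "inner_cuts G X r C \<longleftrightarrow> (\<forall>y \<in> pverts X - {r}. \<not> is_leaf X y \<longrightarrow>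
     cut_set (with_proj G \<restriction> bags X C y) (C y))"

lemma cut_decomposition_iff:
  assumes "pair_graph G"
  shows "cut_decomposition G X r C \<longleftrightarrow> bagged_tree (parcs G) X r C (pverts G) \<and>
    inner_cuts G X r C \<and> (\<not> is_leaf X r \<longrightarrow> cut_set (with_proj G \<restriction> pverts G) (C r))"
proof -
  interpret pair_graph G by fact
  have "cut_decomposition G X r C \<longleftrightarrow> bagged_tree (parcs G) X r C (pverts G) \<and>
    (\<forall>y \<in> pverts X. \<not> is_leaf X y \<longrightarrow> cut_set (with_proj G \<restriction> bags X C y) (C y))"
    unfolding cut_decomposition_def bagged_tree_def bags_def
    using in_arcsD1 in_arcsD2 by fast
  moreover have "r \<in> pverts X" if "bagged_tree (parcs G) X r C (pverts G)"
    using bagged_treeD(1)[OF that] by (simp add: rooted_tree_def)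
  ultimately show ?thesis
    using bags_root[of "parcs G" X r C "pverts G"] unfolding inner_cuts_def by fastforce
qed

text \<open>The root \<open>r'\<close> of the attached tree becomes an inner node, so its cut
  condition enters as a separate premise.\<close>

lemma inner_cuts_graft:
  assumes X: "rooted_tree X r" and X': "rooted_tree X' r'" and disj: "pverts X \<inter> pverts X' = {}"
    and C: "\<And>x. x \<in> pverts X \<Longrightarrow> D x = C x" and C': "\<And>x. x \<in> pverts X' \<Longrightarrow> D x = C' x"
    and cuts: "inner_cuts G X r C" "inner_cuts G X' r' C'"
    and root: "\<not> is_leaf X' r' \<Longrightarrow> cut_set (with_proj G \<restriction> bags X' C' r') (C' r')"
  shows "inner_cuts G (graft X r X' r') r D"
  unfolding inner_cuts_def
proof (intro ballI impI)
  fix y assume y: "y \<in> pverts (graft X r X' r') - {r}" and nl: "\<not> is_leaf (graft X r X' r') y"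
  have r: "r \<in> pverts X" using X by (simp add: rooted_tree_def)
  have sub: "subtree_nodes T y \<subseteq> pverts T" for T
    by (auto simp: subtree_nodes_def)
  show "cut_set (with_proj G \<restriction> bags (graft X r X' r') D y) (D y)"
  proof (cases "y \<in> pverts X")
    case True
    then have "bags (graft X r X' r') D y = bags X C y"
      using y C sub[of X] subtree_nodes_graft(1)[OF X X' disj, of y] by (auto simp: bags_def)
    moreover have "\<not> is_leaf X y"
      using nl True y by (auto simp: is_leaf_def children_graft[OF X X' disj])
    ultimately show ?thesis using cuts(1) True y C by (simp add: inner_cuts_def)
  next
    case False
    then have y': "y \<in> pverts X'" using y by (simp add: graft_def)
    then have "bags (graft X r X' r') D y = bags X' C' y"
      using C' sub[of X'] subtree_nodes_graft(2)[OF X X' disj, of y] by (auto simp: bags_def)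
    moreover have "\<not> is_leaf X' y"
      using nl False y y' by (auto simp: is_leaf_def children_graft[OF X X' disj])
    ultimately show ?thesis using cuts(2) root y' C' by (cases "y = r'") (simp_all add: inner_cuts_def)
  qed
qed

text \<open>Nodes are named after vertices via \<open>f\<close>, so that disjoint vertex sets give disjoint trees.\<close>

definition has_cut_tree :: "'a pair_pre_digraph \<Rightarrow> ('a \<Rightarrow> 'x) \<Rightarrow> 'a set \<Rightarrow> nat \<Rightarrow> bool" where
  "has_cut_tree G f S k \<longleftrightarrow> (\<exists>X r C. bagged_tree (parcs G) X r C S \<and> pverts X \<subseteq> f ` S \<and>
     inner_cuts G X r C \<and> (\<not> is_leaf X r \<longrightarrow> cut_set (with_proj G \<restriction> S) (C r)) \<and>
     node_load X C r \<le> k)"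

text \<open>Collects cut trees of all components of \<open>S\<close> below one node with bag
  \<open>{v}\<close>, splitting off one component \<open>Q\<close> at a time. The premise
  \<open>cut\<close> receives the induction hypothesis of the main construction. Whether
  \<open>{v}\<close> really cuts is left to the caller; the conjunct \<open>S \<noteq> {}\<close>
  supplies the nonempty remainder that a cut set requires.\<close>

lemma cut_trees_of_components:
  assumes "finite S" and f: "inj_on f (insert v S)" and "v \<notin> S"
    and td: "td_le (parcs G) S k"
    and cut: "\<And>Q. Q \<subseteq> S \<Longrightarrow> connected (with_proj G \<restriction> Q) \<Longrightarrow> td_le (parcs G) Q k \<Longrightarrow> has_cut_tree G f Q k"
  shows "\<exists>X C. bagged_tree (parcs G) X (f v) C (insert v S) \<and> pverts X \<subseteq> f ` insert v S \<and>
    inner_cuts G X (f v) C \<and> C (f v) = {v} \<and> (\<not> is_leaf X (f v) \<longrightarrow> S \<noteq> {}) \<and>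
    node_load X C (f v) \<le> Suc k"
  using assms
proof (induction S rule: finite_psubset_induct)
  case (psubset S)
  show ?case
  proof (cases "S = {}")
    case True
    let ?X = "\<lparr>pverts = {f v}, parcs = {}\<rparr>"
    have "is_leaf ?X (f v)" by (simp add: is_leaf_def children_def)
    then show ?thesis using True bagged_tree_singleton_node[of "parcs G" "f v" "{v}"]
      by (intro exI[of _ ?X] exI[of _ "\<lambda>_. {v}"]) (simp add: inner_cuts_def node_load_leaf)
  next
    case False
    then obtain Q where Q: "Q \<subseteq> S" "connected (with_proj G \<restriction> Q)" "separated (parcs G) Q (S - Q)"
      using connected_component_exists[OF psubset.hyps] by blast
    have "Q \<noteq> {}" using Q(2) by (simp add: connected_induce_iff)
    then have less: "S - Q \<subset> S" using Q(1) by blast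
    have "inj_on f (insert v (S - Q))"
      using psubset.prems(1) by (rule inj_on_subset) auto
    then obtain X C where X: "bagged_tree (parcs G) X (f v) C (insert v (S - Q))"
      "pverts X \<subseteq> f ` insert v (S - Q)" "inner_cuts G X (f v) C" "C (f v) = {v}"
      "node_load X C (f v) \<le> Suc k"
      using psubset.IH[OF less] psubset.prems td_le_subset[OF psubset.prems(3)] less by auto
    obtain X' r' C' where X': "bagged_tree (parcs G) X' r' C' Q" "pverts X' \<subseteq> f ` Q"
      "inner_cuts G X' r' C'" "\<not> is_leaf X' r' \<longrightarrow> cut_set (with_proj G \<restriction> Q) (C' r')"
      "node_load X' C' r' \<le> k"
      using psubset.prems(4)[OF Q(1,2)] td_le_subset[OF psubset.prems(3) Q(1)]
      unfolding has_cut_tree_def by blast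
    \<comment> \<open>Injectivity of \<open>f\<close> turns disjointness of vertex sets into
      disjointness of node names.\<close>
    have "f ` insert v (S - Q) \<inter> f ` Q = f ` (insert v (S - Q) \<inter> Q)"
      using Q(1) by (intro inj_on_image_Int[OF psubset.prems(1), symmetric]) auto
    then have disj: "pverts X \<inter> pverts X' = {}"
      using X(2) X'(2) psubset.prems(2) Q(1) by auto
    define D where "D = (\<lambda>x. if x \<in> pverts X then C x else C' x)"
    have D: "\<And>x. x \<in> pverts X \<Longrightarrow> D x = C x" "\<And>x. x \<in> pverts X' \<Longrightarrow> D x = C' x"
      using disj by (auto simp: D_def)
    note rt = bagged_treeD(1)[OF X(1)] and rt' = bagged_treeD(1)[OF X'(1)]
    have root: "f v \<in> pverts X" using rt by (simp add: rooted_tree_def)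
    have eq: "insert v S = insert v (S - Q) \<union> Q" using Q(1) by blast
    have "bagged_tree (parcs G) (graft X (f v) X' r') (f v) D (insert v S)"
      unfolding eq using Q psubset.prems(2) D disj X(4)
      by (intro bagged_tree_graft[OF X(1) X'(1)]) (auto simp: separated_def)
    moreover have "inner_cuts G (graft X (f v) X' r') (f v) D"
      using X(3) X'(3,4) D bags_root[OF X'(1)] by (intro inner_cuts_graft[OF rt rt' disj]) auto
    moreover have "node_load (graft X (f v) X' r') D (f v) \<le> Suc k"
      using node_load_graft_le_iff[OF rt rt' disj D] X(4,5) X'(5) by simp
    moreover have "pverts (graft X (f v) X' r') \<subseteq> f ` insert v S"
      using X(2) X'(2) Q(1) by (auto simp: graft_def)
    moreover have "D (f v) = {v}" using D(1)[OF root] X(4) by simp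
    ultimately show ?thesis using False by blast
  qed
qed

text \<open>Adding \<open>v\<close> to the root bag leaves the remainder \<open>S - C r\<close>
  unchanged, so a cut at the root stays a cut. Edges at \<open>v\<close> are harmless because the
  root is an ancestor of every node, and each branch becomes heavier by exactly one.\<close>

lemma has_cut_tree_insert_root:
  assumes S: "finite S" "v \<notin> S" and "has_cut_tree G f S k"
  shows "has_cut_tree G f (insert v S) (Suc k)"
proof -
  obtain X r C where X: "bagged_tree (parcs G) X r C S" "pverts X \<subseteq> f ` S" "inner_cuts G X r C"
    "\<not> is_leaf X r \<longrightarrow> cut_set (with_proj G \<restriction> S) (C r)" "node_load X C r \<le> k"
    using assms(3) unfolding has_cut_tree_def by blast
  note bt = bagged_treeD[OF X(1)]
  have root: "r \<in> pverts X" using bt(1) by (simp add: rooted_tree_def)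
  have above: "ancestor X r y" if "y \<in> pverts X" for y
    using that root rooted_tree_root_reaches[OF bt(1)] by (simp add: ancestor_iff[OF bt(1)])
  define D where "D = C(r := insert v (C r))"
  have D: "D r = insert v (C r)" "\<And>x. x \<noteq> r \<Longrightarrow> D x = C x" "\<And>x. C x \<subseteq> D x"
    by (auto simp: D_def)
  have v: "v \<notin> C x" if "x \<in> pverts X" for x using bt(2)[OF that] S by blast
  have "bagged_tree (parcs G) X r D (insert v S)"
  proof (rule bagged_treeI[OF bt(1)])
    show "D x \<subseteq> insert v S" if "x \<in> pverts X" for x
      using bt(2)[OF that] by (auto simp: D_def)
    show "x = y" if "x \<in> pverts X" "y \<in> pverts X" "w \<in> D x" "w \<in> D y" for x y w
      using that v bt(3)[of x y w] by (auto simp: D_def split: if_splits)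
    show cover: "\<exists>x \<in> pverts X. w \<in> D x" if "w \<in> insert v S" for w
      using that bt(4)[of w] root D by blast
    fix a b assume ab: "(a, b) \<in> parcs G" "a \<in> insert v S" "b \<in> insert v S"
    consider "a \<in> S" "b \<in> S" | "a = v" | "b = v" using ab by blast
    then show "\<exists>x \<in> pverts X. \<exists>y \<in> pverts X. a \<in> D x \<and> b \<in> D y \<and> (ancestor X x y \<or> ancestor X y x)"
    proof cases
      case 1
      then show ?thesis using bt(5)[OF ab(1)] D(3) by blast
    next
      case 2
      then show ?thesis using cover[OF ab(3)] D(1) root above by blast
    next
      case 3
      then show ?thesis using cover[OF ab(2)] D(1) root above by blast
    qed
  qed
  moreover have "inner_cuts G X r D"
    unfolding inner_cuts_def
  proof (intro ballI impI)
    fix y assume y: "y \<in> pverts X - {r}" and nl: "\<not> is_leaf X y"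
    \<comment> \<open>The modified root bag is invisible from below.\<close>
    have "(y, r) \<notin> (parcs X)\<^sup>*"
      using y rooted_tree_no_arc_to_root[OF bt(1)] by (auto elim: rtranclE)
    then have "bags X D y = bags X C y"
      using subtree_nodes_eq[OF bt(1), of y] y by (auto simp: bags_def D_def)
    then show "cut_set (with_proj G \<restriction> bags X D y) (D y)"
      using X(3) y nl D(2) by (simp add: inner_cuts_def)
  qed
  moreover have "cut_set (with_proj G \<restriction> insert v S) (D r)" if "\<not> is_leaf X r"
  proof -
    have "cut_set (with_proj G \<restriction> S) (C r)" using X(4) that by blast
    moreover have "insert v S - D r = S - C r" using S(2) D(1) by auto
    ultimately show ?thesis using D(1) by (auto simp: cut_set_induce_iff)
  qed
  moreover have "node_load X D r \<le> Suc k"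
  proof -
    have "node_load X D y = node_load X C y" if "y \<in> children X r" for y
    proof (rule node_load_cong[OF bt(1) bt(1)])
      have closed: "children X z \<subseteq> pverts X - {r}" for z
        using rooted_tree_no_arc_to_root[OF bt(1)] rooted_tree_arcs_in_verts[OF bt(1)]
        by (auto simp: children_def)
      show "y \<in> pverts X - {r}" using closed that by blast
      show "z \<in> pverts X \<and> z \<in> pverts X \<and> children X z = children X z \<and>
        children X z \<subseteq> pverts X - {r} \<and> D z = C z" if "z \<in> pverts X - {r}" for z
        using that closed D(2) by auto
    qed
    moreover have "finite (C r)" using bt(2)[OF root] S(1) finite_subset by blast
    then have "card (D r) = Suc (card (C r))" using D(1) v[OF root] by simp
    ultimately show ?thesis using X(5) by (auto simp: node_load_le_iff[OF bt(1) root])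
  qed
  ultimately show ?thesis using X(2) unfolding has_cut_tree_def by blast
qed

lemma td_le_imp_has_cut_tree:
  assumes "finite S" and "inj_on f S" and "td_le (parcs G) S k" and "connected (with_proj G \<restriction> S)"
  shows "has_cut_tree G f S k"
  using assms
proof (induction S arbitrary: k rule: finite_psubset_induct)
  case (psubset S)
  obtain v l where v: "v \<in> S" "k = Suc l" "td_le (parcs G) (S - {v}) l"
    using td_le_connected_cases psubset.prems by metis
  have less: "S - {v} \<subset> S" and S: "insert v (S - {v}) = S" using v(1) by auto
  have IH: "has_cut_tree G f Q j"
    if "Q \<subseteq> S - {v}" "connected (with_proj G \<restriction> Q)" "td_le (parcs G) Q j" for Q j
    using psubset.IH[of Q j] that less inj_on_subset[OF psubset.prems(1)] by blast
  show ?case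
  proof (cases "connected (with_proj G \<restriction> (S - {v}))")
    case True
    then have "has_cut_tree G f (insert v (S - {v})) (Suc l)"
      using IH v(3) psubset.hyps by (intro has_cut_tree_insert_root) auto
    then show ?thesis using S v(2) by simp
  next
    \<comment> \<open>This includes \<open>S = {v}\<close>, as the empty set is not connected; the
      node is then a leaf and no cut is demanded.\<close>
    case False
    obtain X C where X: "bagged_tree (parcs G) X (f v) C S" "pverts X \<subseteq> f ` S"
      "inner_cuts G X (f v) C" "C (f v) = {v}" "\<not> is_leaf X (f v) \<longrightarrow> S - {v} \<noteq> {}"
      "node_load X C (f v) \<le> Suc l"
      using cut_trees_of_components[of "S - {v}" f v G l] psubset.hyps psubset.prems(1) v(3) IH
      unfolding S by auto
    have "\<not> is_leaf X (f v) \<longrightarrow> cut_set (with_proj G \<restriction> S) (C (f v))"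
      using X(4,5) False v(1) by (simp add: cut_set_induce_iff)
    then show ?thesis using X v(2) unfolding has_cut_tree_def by blast
  qed
qed

section \<open>Load and treedepth\<close>

lemma induce_subgraph_all_verts:
  assumes "pair_graph G"
  shows "with_proj G \<restriction> pverts G = with_proj G"
proof -
  interpret pair_graph G by fact
  show ?thesis using in_arcsD1 in_arcsD2 by (auto simp: induce_subgraph_def with_proj_def)
qed

lemma cut_decomposition_exists_iff:
  fixes G :: "'a pair_pre_digraph"
  assumes G: "pair_graph G" and "connected G"
  shows "(\<exists>(X :: nat pair_pre_digraph) r C. cut_decomposition G X r C \<and> node_load X C r \<le> k) \<longleftrightarrow>
    td_le (parcs G) (pverts G) k"
proof
  interpret pair_graph G by fact
  {
    assume "\<exists>(X :: nat pair_pre_digraph) r C. cut_decomposition G X r C \<and> node_load X C r \<le> k"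
    then obtain X :: "nat pair_pre_digraph" and r C
      where "cut_decomposition G X r C" and X: "node_load X C r \<le> k" by blast
    then have bt: "bagged_tree (parcs G) X r C (pverts G)" by (simp add: cut_decomposition_iff[OF G])
    then have "r \<in> pverts X" by (simp add: bagged_tree_def rooted_tree_def)
    then have "td_le (parcs G) (pverts G) (node_load X C r)"
      using td_le_bags[OF bt pair_finite_verts] bags_root[OF bt] by fastforce
    then show "td_le (parcs G) (pverts G) k" using X by (rule td_le_mono)
  }
  assume td: "td_le (parcs G) (pverts G) k"
  obtain f :: "'a \<Rightarrow> nat" where "inj_on f (pverts G)"
    using finite_imp_inj_to_nat_seg[OF pair_finite_verts] by blast
  then have "has_cut_tree G f (pverts G) k"
    using td assms(2) induce_subgraph_all_verts[OF G] by (intro td_le_imp_has_cut_tree) auto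
  then show "\<exists>(X :: nat pair_pre_digraph) r C. cut_decomposition G X r C \<and> node_load X C r \<le> k"
    unfolding has_cut_tree_def cut_decomposition_iff[OF G] by blast
qed

lemma elimination_tree_exists_iff:
  fixes G :: "'a pair_pre_digraph"
  assumes G: "pair_graph G" and conn: "connected G"
  shows "(\<exists>T r. rooted_tree T r \<and> pverts T = pverts G \<and> subgraph G (clos T) \<and> Suc (height T r) \<le> k) \<longleftrightarrow>
    td_le (parcs G) (pverts G) k"
proof
  interpret pair_graph G by fact
  {
    assume "\<exists>T r. rooted_tree T r \<and> pverts T = pverts G \<and> subgraph G (clos T) \<and> Suc (height T r) \<le> k"
    then obtain T r where T: "rooted_tree T r" "pverts T = pverts G" "subgraph G (clos T)"
      "Suc (height T r) \<le> k" by blast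
    have "parcs G \<subseteq> parcs (clos T)" using T(3) by (simp add: subgraph_def)
    then have bt: "bagged_tree (parcs G) T r (\<lambda>x. {x}) (pverts G)"
      using T(1,2) by (intro bagged_treeI) (auto simp: clos_def)
    have "r \<in> pverts T" using T(1) by (simp add: rooted_tree_def)
    then have "td_le (parcs G) (pverts G) (Suc (height T r))"
      using td_le_bags[OF bt] bags_root[OF bt] node_load_singletons[OF T(1)] by fastforce
    then show "td_le (parcs G) (pverts G) k" using T(4) td_le_mono by blast
  }
  assume "td_le (parcs G) (pverts G) k"
  moreover have "connected (with_proj G \<restriction> pverts G)"
    using conn induce_subgraph_all_verts[OF G] by simp
  ultimately obtain v l where v: "v \<in> pverts G" "k = Suc l" "td_le (parcs G) (pverts G - {v}) l"
    by (rule td_le_connected_cases)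
  then obtain T where T: "bagged_tree (parcs G) T v (\<lambda>x. {x}) (pverts G)" "pverts T = pverts G"
    "node_load T (\<lambda>x. {x}) v \<le> k"
    \<comment> \<open>The extra level of this lemma is no loss: the added root is the first
      eliminated vertex, and \<open>Suc l\<close> is \<open>k\<close>.\<close>
    using td_le_imp_bagged_tree_singletons[of "parcs G" "pverts G - {v}" l v]
    by (auto simp: insert_absorb)
  note bt = bagged_treeD[OF T(1)]
  have "ancestor T a b \<or> ancestor T b a" if "(a, b) \<in> parcs G" for a b
    using bt(5)[OF that] that in_arcsD1 in_arcsD2 by blast
  moreover have "a \<noteq> b" if "(a, b) \<in> parcs G" for a b
    using pair_no_loops[OF that] by simp
  moreover have "pair_wf_digraph (clos T)"
    using rooted_tree_rtrancl_in_verts[OF bt(1)]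
    by unfold_locales (auto simp: clos_def ancestor_iff[OF bt(1)])
  then have "wf_digraph (with_proj (clos T))" by (simp add: wf_digraph_wp_iff)
  moreover have "wf_digraph (with_proj G)" by unfold_locales
  ultimately have "subgraph G (clos T)"
    using T(2) by (auto simp: subgraph_def compatible_def clos_def)
  then show "\<exists>T r. rooted_tree T r \<and> pverts T = pverts G \<and> subgraph G (clos T) \<and> Suc (height T r) \<le> k"
    using bt(1) T(2,3) node_load_singletons[OF bt(1)] by metis
qed

theorem theorem8:
  fixes G :: "'a pair_pre_digraph"
  assumes "pair_graph G" and "connected G"
  shows "load G = treedepth G"
proof -
  interpret pair_graph G by fact
  let ?td = "td_le (parcs G) (pverts G)"
  \<comment> \<open>Eliminating all vertices one by one shows that the minimum is attained.\<close>
  have "?td (card (pverts G))"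
    using td_le_Un_card[OF pair_finite_verts td_le_empty[of "parcs G" 0]] by simp
  then have least: "?td (Least ?td)" by (rule LeastI)
  note cut = cut_decomposition_exists_iff[OF assms] and elim = elimination_tree_exists_iff[OF assms]
  have "load G = Least ?td"
    unfolding load_def
  proof (rule Least_equality)
    obtain X :: "nat pair_pre_digraph" and r C
      where "cut_decomposition G X r C" "node_load X C r \<le> Least ?td"
      using least cut by blast
    moreover from this have "Least ?td \<le> node_load X C r"
      using cut by (intro Least_le) blast
    ultimately show "\<exists>(X :: nat pair_pre_digraph) r C. cut_decomposition G X r C \<and> Least ?td = node_load X C r"
      by (metis order_antisym)
  next
    fix k assume "\<exists>(X :: nat pair_pre_digraph) r C. cut_decomposition G X r C \<and> k = node_load X C r"
    then show "Least ?td \<le> k" using cut by (intro Least_le) blast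
  qed
  moreover have "(LEAST h. \<exists>T r. rooted_tree T r \<and> pverts T = pverts G \<and>
     subgraph G (clos T) \<and> h = height T r) = Least ?td - 1"
  proof (rule Least_equality)
    obtain T r where T: "rooted_tree T r" "pverts T = pverts G" "subgraph G (clos T)"
      "Suc (height T r) \<le> Least ?td"
      using least elim by blast
    then have "Least ?td \<le> Suc (height T r)"
      using elim by (intro Least_le) blast
    then have "Least ?td - 1 = height T r" using T(4) by simp
    then show "\<exists>T r. rooted_tree T r \<and> pverts T = pverts G \<and> subgraph G (clos T) \<and>
      Least ?td - 1 = height T r" using T by blast
  next
    fix h assume "\<exists>T r. rooted_tree T r \<and> pverts T = pverts G \<and> subgraph G (clos T) \<and> h = height T r"
    then have "Least ?td \<le> Suc h" using elim by (intro Least_le) blast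
    then show "Least ?td - 1 \<le> h" by simp
  qed
  \<comment> \<open>Positivity makes the truncated subtraction exact, so that
    \<open>1 + (Least ?td - 1)\<close> is \<open>Least ?td\<close>.\<close>
  moreover have "0 < Least ?td" using least elim by fastforce
  ultimately show ?thesis by (simp add: treedepth_def)
qed

end
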